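(* Let the polynomials $P_m(z)$, $m\ge 0$, be defined by the generating function \[ \sum_{m=0}^{\infty}P_m(z)t^m=\frac{1}{t^4z^2+t^3(-2z-36)+t^2(49-2z)-14t+1}. \] Then for every $m$, all zeros of $P_m(z)$ lie in the interval $(-\infty,-9/4)$. *)

theory Defs
  imports Complex_Main "HOL-Computational_Algebra.Polynomial"
    "HOL-Computational_Algebra.Formal_Power_Series"
begin

(* The denominator as a formal power series in t = fps_X, for a fixed complex value of z. *)
definition gen_denom :: "complex \<Rightarrow> complex fps" where
  "gen_denom z =
     fps_X ^ 4 * fps_const (z ^ 2) + fps_X ^ 3 * fps_const (- 2 * z - 36)
     + fps_X ^ 2 * fps_const (49 - 2 * z) - 14 * fps_X + 1"

(* The generating function identity, taken at every z, determines the polynomials P m. *)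
lemma gen_fun_ex1:
  "\<exists>!P :: nat \<Rightarrow> complex poly.
     \<forall>z. Abs_fps (\<lambda>m. poly (P m) z) = 1 / gen_denom z"
proof (rule ex_ex1I)
  define D :: "complex poly fps" where
    "D = fps_X ^ 4 * fps_const [:0, 0, 1:] + fps_X ^ 3 * fps_const [:- 36, - 2:]
         + fps_X ^ 2 * fps_const [:49, - 2:] - fps_const [:14:] * fps_X + 1"
  define Q where "Q = fps_right_inverse D 1"
  have "D * Q = 1"
    unfolding Q_def by (rule fps_right_inverse) (simp add: D_def)
  have D_nth: "poly (fps_nth D n) z = fps_nth (gen_denom z) n" for n z
    by (simp add: D_def gen_denom_def fps_X_power_mult_nth numeral_fps_const
        power2_eq_square algebra_simps)
  have "Abs_fps (\<lambda>m. poly (fps_nth Q m) z) = 1 / gen_denom z" for z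
  proof -
    have "gen_denom z * Abs_fps (\<lambda>m. poly (fps_nth Q m) z) = 1"
    proof (rule fps_ext)
      fix n
      have "fps_nth (gen_denom z * Abs_fps (\<lambda>m. poly (fps_nth Q m) z)) n = poly (fps_nth (D * Q) n) z"
        by (simp add: fps_mult_nth poly_sum D_nth)
      then show "fps_nth (gen_denom z * Abs_fps (\<lambda>m. poly (fps_nth Q m) z)) n = fps_nth 1 n"
        by (simp add: \<open>D * Q = 1\<close>)
    qed
    then show ?thesis
      by (metis mult_zero_left nonzero_mult_div_cancel_left zero_neq_one)
  qed
  then show "\<exists>P. \<forall>z. Abs_fps (\<lambda>m. poly (P m) z) = 1 / gen_denom z"
    by (intro exI[of _ "fps_nth Q"]) simp
next
  fix P P' :: "nat \<Rightarrow> complex poly"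
  assume "\<forall>z. Abs_fps (\<lambda>m. poly (P m) z) = 1 / gen_denom z"
    and "\<forall>z. Abs_fps (\<lambda>m. poly (P' m) z) = 1 / gen_denom z"
  then have "poly (P m) z = poly (P' m) z" for m z
    by (metis fps_nth_Abs_fps)
  then show "P = P'"
    by (intro ext) (metis poly_eq_poly_eq_iff ext)
qed

end

theory Submission
  imports Defs "HOL-Real_Asymp.Real_Asymp"
begin

text \<open>
  With $t = s^2$ and $z = -(u^2-1)(v^2-1)$, where $u^2 + v^2 = 5$, the denominator splits
  completely, and the reciprocals of its zeros in $t$ are $(1 \pm u)^2$ and $(1 \pm v)^2$.
  Taking $v = \overline u$ with $u = p + iq$, $q > 0$, $p^2 - q^2 = 5/2$ parametrises
  $z < -9/4$ injectively by $q$. Partial fractions then express $P_m(z)$ as a positive multiple of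
  \[ \mathrm{Im}\; \frac1u \left( \frac{(1+u)^{2m+6}}{(1+p)(1+iq)}
      + \frac{(1-u)^{2m+6}}{(p-1)(1-iq)} \right). \]
  The first summand strictly dominates the second, and its argument runs continuously from $0$
  (at $q = 0$) to $m\pi/2 + 3\pi/4$ (as $q \to \infty$). So the sign alternates at the
  $\lfloor m/2 \rfloor + 1$ successive points where this argument is $\pi/2 + k\pi$, which yields
  $\lfloor m/2 \rfloor$ zeros in $(-\infty, -9/4)$; as $\deg P_m \le m/2$, there are no others.
\<close>

section \<open>Partial fractions and linear recurrences of order four\<close>

text \<open>\<open>G n\<close> is the divided difference of x^n at the four nodes: it kills degrees
  below 3 and equals 1 at x^3. Each summand is a constant times the n-th power of a root of the
  characteristic polynomial, hence the recurrence.\<close>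

lemma partial_fraction_sum_recurrence:
  fixes a b c d :: "'a :: field"
  defines "G \<equiv> \<lambda>n. a ^ n / ((a - b) * (a - c) * (a - d)) + b ^ n / ((b - a) * (b - c) * (b - d))
     + c ^ n / ((c - a) * (c - b) * (c - d)) + d ^ n / ((d - a) * (d - b) * (d - c))"
  assumes "a \<noteq> b" "a \<noteq> c" "a \<noteq> d" "b \<noteq> c" "b \<noteq> d" "c \<noteq> d"
  shows "G 0 = 0" "G 1 = 0" "G 2 = 0" "G 3 = 1"
    "G (n + 4) = (a + b + c + d) * G (n + 3)
       - (a * b + a * c + a * d + b * c + b * d + c * d) * G (n + 2)
       + (a * b * c + a * b * d + a * c * d + b * c * d) * G (n + 1) - a * b * c * d * G n"
proof -
  have ne: "a - b \<noteq> 0" "a - c \<noteq> 0" "a - d \<noteq> 0" "b - c \<noteq> 0" "b - d \<noteq> 0" "c - d \<noteq> 0"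
    using assms by auto
  have G: "G n = (a ^ n * ((b - c) * (b - d) * (c - d)) - b ^ n * ((a - c) * (a - d) * (c - d))
      + c ^ n * ((a - b) * (a - d) * (b - d)) - d ^ n * ((a - b) * (a - c) * (b - c)))
      / ((a - b) * (a - c) * (a - d) * (b - c) * (b - d) * (c - d))" for n
  proof -
    \<comment> \<open>Only signs and a common denominator are involved here, so the six differences
      can be treated as independent quantities.\<close>
    define x1 x2 x3 x4 x5 x6 where x: "x1 = a - b" "x2 = a - c" "x3 = a - d" "x4 = b - c"
      "x5 = b - d" "x6 = c - d"
    have eqs: "a - b = x1" "a - c = x2" "a - d = x3" "b - c = x4" "b - d = x5" "c - d = x6"
      "b - a = - x1" "c - a = - x2" "d - a = - x3" "c - b = - x4" "d - b = - x5" "d - c = - x6"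
      by (simp_all add: x)
    show ?thesis
      using ne unfolding G_def eqs by (simp add: add_divide_distrib diff_divide_distrib mult.assoc)
  qed
  show "G 0 = 0" "G 1 = 0" "G 2 = 0"
    unfolding G using ne by (simp_all add: algebra_simps power2_eq_square)
  \<comment> \<open>The Vandermonde determinant, expanded along its row of cubes.\<close>
  have "a ^ 3 * ((b - c) * (b - d) * (c - d)) - b ^ 3 * ((a - c) * (a - d) * (c - d))
      + c ^ 3 * ((a - b) * (a - d) * (b - d)) - d ^ 3 * ((a - b) * (a - c) * (b - c))
      = (a - b) * (a - c) * (a - d) * (b - c) * (b - d) * (c - d)"
    by (simp add: algebra_simps power3_eq_cube)
  then show "G 3 = 1"
    unfolding G using ne by simp
  define e1 e2 e3 e4 where e: "e1 = a + b + c + d"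
    "e2 = a * b + a * c + a * d + b * c + b * d + c * d"
    "e3 = a * b * c + a * b * d + a * c * d + b * c * d" "e4 = a * b * c * d"
  have x: "x ^ (n + 4) = e1 * x ^ (n + 3) - e2 * x ^ (n + 2) + e3 * x ^ (n + 1) - e4 * x ^ n"
    if "x \<in> {a, b, c, d}" for x
  proof -
    have "x ^ 4 = e1 * x ^ 3 - e2 * x ^ 2 + e3 * x - e4"
      using that by (auto simp: e algebra_simps power2_eq_square power3_eq_cube power4_eq_xxxx)
    then have "x ^ n * x ^ 4 = x ^ n * (e1 * x ^ 3 - e2 * x ^ 2 + e3 * x - e4)"
      by (rule arg_cong)
    also have "\<dots> = e1 * (x ^ n * x ^ 3) - e2 * (x ^ n * x ^ 2) + e3 * (x ^ n * x) - e4 * x ^ n"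
      by (simp add: algebra_simps)
    finally show ?thesis by (simp only: power_add power_one_right)
  qed
  have "G (n + 4) = e1 * G (n + 3) - e2 * G (n + 2) + e3 * G (n + 1) - e4 * G n"
    unfolding G_def by (subst (1 2 3 4) x) (simp_all add: add_divide_distrib diff_divide_distrib ring_distribs)
  then show "G (n + 4) = (a + b + c + d) * G (n + 3)
       - (a * b + a * c + a * d + b * c + b * d + c * d) * G (n + 2)
       + (a * b * c + a * b * d + a * c * d + b * c * d) * G (n + 1) - a * b * c * d * G n"
    by (simp only: e)
qed

text \<open>Shifting the coefficients by three zeros makes the recurrence hold from index 0 on.\<close>

lemma gen_denom_inverse_recurrence:
  fixes f :: "nat \<Rightarrow> complex"
  assumes "Abs_fps f = 1 / gen_denom z"
  defines "g \<equiv> \<lambda>n. if n < 3 then 0 else f (n - 3)"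
  shows "g 3 = 1"
    and "g (n + 4) = 14 * g (n + 3) - (49 - 2 * z) * g (n + 2) + (2 * z + 36) * g (n + 1) - z ^ 2 * g n"
proof -
  have nth: "fps_nth (gen_denom z * Abs_fps f) n
      = z ^ 2 * (if n < 4 then 0 else f (n - 4)) + (- 2 * z - 36) * (if n < 3 then 0 else f (n - 3))
        + (49 - 2 * z) * (if n < 2 then 0 else f (n - 2)) - 14 * (if n < 1 then 0 else f (n - 1)) + f n" for n
  proof -
    have "gen_denom z * Abs_fps f = fps_const (z ^ 2) * (fps_X ^ 4 * Abs_fps f)
        + fps_const (- 2 * z - 36) * (fps_X ^ 3 * Abs_fps f)
        + fps_const (49 - 2 * z) * (fps_X ^ 2 * Abs_fps f)
        - fps_const 14 * (fps_X ^ 1 * Abs_fps f) + Abs_fps f"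
      unfolding gen_denom_def numeral_fps_const by (simp add: ring_distribs mult_ac)
    then show ?thesis
      by (simp only: fps_add_nth fps_sub_nth fps_mult_left_const_nth fps_X_power_mult_nth fps_nth_Abs_fps)
  qed
  have "fps_nth (gen_denom z) 0 \<noteq> 0"
    by (simp add: gen_denom_def)
  then have "gen_denom z * Abs_fps f = 1"
    unfolding assms by (metis fps_divide_unit inverse_mult_eq_1' mult_1)
  then have eq: "fps_nth (gen_denom z * Abs_fps f) n = (if n = 0 then 1 else 0)" for n
    by simp
  show "g 3 = 1"
    using eq[of 0] unfolding nth by (simp add: g_def)
  \<comment> \<open>The coefficient of t^(n+1) is never the constant one, so it vanishes for every
    \<open>n\<close>. The cases in which the truncated subtraction would matter are exactly the
    padding zeros of \<open>g\<close>.\<close>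
  have "(if n + 1 < 4 then 0 else f (n + 1 - 4)) = g n"
    "(if n + 1 < 3 then 0 else f (n + 1 - 3)) = g (n + 1)"
    "(if n + 1 < 2 then 0 else f (n + 1 - 2)) = g (n + 2)"
    "(if n + 1 < 1 then 0 else f (n + 1 - 1)) = g (n + 3)" "f (n + 1) = g (n + 4)"
    by (auto simp: g_def intro!: arg_cong[of _ _ f])
  then have "z ^ 2 * g n + (- 2 * z - 36) * g (n + 1) + (49 - 2 * z) * g (n + 2) - 14 * g (n + 3) + g (n + 4) = 0"
    using eq[of "n + 1"] unfolding nth by simp
  then show "g (n + 4) = 14 * g (n + 3) - (49 - 2 * z) * g (n + 2) + (2 * z + 36) * g (n + 1) - z ^ 2 * g n"
    by (simp add: algebra_simps eq_diff_eq)
qed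

lemma linear_recurrence4_unique:
  fixes g h :: "nat \<Rightarrow> 'a :: comm_ring_1"
  assumes "\<And>n. g (n + 4) = e1 * g (n + 3) - e2 * g (n + 2) + e3 * g (n + 1) - e4 * g n"
    and "\<And>n. h (n + 4) = e1 * h (n + 3) - e2 * h (n + 2) + e3 * h (n + 1) - e4 * h n"
    and "g 0 = h 0" "g 1 = h 1" "g 2 = h 2" "g 3 = h 3"
  shows "g n = h n"
proof (induction n rule: less_induct)
  case (less n)
  show ?case
  proof (cases "n < 4")
    case True
    then have "n = 0 \<or> n = 1 \<or> n = 2 \<or> n = 3" by linarith
    then show ?thesis using assms by auto
  next
    case False
    then obtain k where "n = k + 4" by (metis le_add_diff_inverse2 not_less)
    then show ?thesis using less assms(1,2)[of k] by simp
  qed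
qed

section \<open>Degree bound\<close>

text \<open>In the denominator the coefficient of t^j has degree at most j/2 in z. The recurrence
  for the polynomials therefore gains at most j/2 degrees over j index steps.\<close>

lemma degree_gen_denom_coeff:
  fixes P :: "nat \<Rightarrow> complex poly"
  assumes gf: "\<And>z :: complex. Abs_fps (\<lambda>m. poly (P m) z) = 1 / gen_denom z"
  shows "2 * degree (P m) \<le> m"
proof -
  define Q where "Q = (\<lambda>n. if n < 3 then 0 else P (n - 3))"
  have Q: "poly (Q n) z = (if n < 3 then 0 else poly (P (n - 3)) z)" for n z
    by (simp add: Q_def)
  have 3: "Q 3 = 1"
  proof (rule poly_eq_poly_eq_iff[THEN iffD1], rule ext)
    show "poly (Q 3) z = poly 1 z" for z
      using gen_denom_inverse_recurrence(1)[OF gf, of z] unfolding Q[symmetric] by simp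
  qed
  have rec: "Q (n + 4) = smult 14 (Q (n + 3)) - [:49, -2:] * Q (n + 2) + [:36, 2:] * Q (n + 1)
      - [:0, 0, 1:] * Q n" for n
  proof (rule poly_eq_poly_eq_iff[THEN iffD1], rule ext)
    fix z
    show "poly (Q (n + 4)) z = poly (smult 14 (Q (n + 3)) - [:49, -2:] * Q (n + 2)
        + [:36, 2:] * Q (n + 1) - [:0, 0, 1:] * Q n) z"
      using gen_denom_inverse_recurrence(2)[OF gf, of n z]
      unfolding Q[symmetric] by (simp add: algebra_simps power2_eq_square)
  qed
  have bound: "2 * degree (Q n) \<le> n - 3" for n
  proof (induction n rule: less_induct)
    case (less n)
    show ?case
    proof (cases "n < 4")
      case True
      then have "n < 3 \<or> n = 3" by linarith
      then show ?thesis using 3 by (auto simp: Q_def)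
    next
      case False
      then obtain k where k: "n = k + 4" by (metis le_add_diff_inverse2 not_less)
      have lin: "2 * degree (p * q) \<le> 2 * d + 2 * degree q" if "degree p \<le> d" for p q :: "complex poly" and d
        using degree_mult_le[of p q] that by linarith
      \<comment> \<open>Where \<open>n - 3\<close> truncates, the induction hypothesis bounds the
        degree of the factor by 0 only, which is too weak after multiplication by the coefficient.
        The factor being 0 settles these cases.\<close>
      have Q0: "Q k = 0" if "k < 3" using that by (simp add: Q_def)
      have Q1: "Q (k + 1) = 0" if "k < 2" using that by (simp add: Q_def)
      have Q2: "Q (k + 2) = 0" if "k < 1" using that by (simp add: Q_def)
      have A: "2 * degree (smult 14 (Q (k + 3))) \<le> k + 1"
        using less[of "k + 3"] k by simp
      have B: "2 * degree ([:49, -2:] * Q (k + 2)) \<le> k + 1"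
        using less[of "k + 2"] k lin[of "[:49, -2:]" 1 "Q (k + 2)"] Q2 by (cases "k < 1") auto
      have C: "2 * degree ([:36, 2:] * Q (k + 1)) \<le> k + 1"
        using less[of "k + 1"] k lin[of "[:36, 2:]" 1 "Q (k + 1)"] Q1 by (cases "k < 2") auto
      have D: "2 * degree ([:0, 0, 1:] * Q k) \<le> k + 1"
        using less[of k] k lin[of "[:0, 0, 1:]" 2 "Q k"] Q0 by (cases "k < 3") auto
      have "degree (Q n) \<le> (k + 1) div 2"
        unfolding k rec using A B C D by (intro degree_diff_le degree_add_le) linarith+
      then show ?thesis using k by linarith
    qed
  qed
  show ?thesis
    using bound[of "m + 3"] by (simp add: Q_def)
qed

section \<open>Polar form, the parametrisation by q, and the coefficients as imaginary parts\<close>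

lemma Complex_eq_cis_arctan:
  assumes "a > 0"
  shows "Complex a b = of_real (cmod (Complex a b)) * cis (arctan (b / a))"
proof -
  have "sqrt (1 + (b / a)\<^sup>2) = cmod (Complex a b) / a"
  proof -
    have "1 + (b / a)\<^sup>2 = (a\<^sup>2 + b\<^sup>2) / a\<^sup>2"
      using assms by (simp add: field_simps)
    then show ?thesis using assms by (simp add: real_sqrt_divide complex_norm)
  qed
  moreover have "cmod (Complex a b) \<noteq> 0" using assms by (simp add: complex_eq_iff)
  ultimately show ?thesis
    using assms by (simp add: complex_eq_iff cos_arctan sin_arctan)
qed

text \<open>The real part p of u = p + iq, fixed by p^2 - q^2 = 5/2, that is, by u^2 + v^2 = 5 for v
  the conjugate of u.\<close>

definition abscissa :: "real \<Rightarrow> real" where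
  "abscissa q = sqrt (5 / 2 + q\<^sup>2)"

lemma abscissa_square: "(abscissa q)\<^sup>2 = 5 / 2 + q\<^sup>2"
  by (simp add: abscissa_def add_nonneg_nonneg)

lemma abscissa_gt_1: "abscissa q > 1"
proof -
  have "1 < 5 / 2 + q\<^sup>2" using zero_le_power2[of q] by linarith
  then show ?thesis by (simp add: abscissa_def)
qed

text \<open>This is -|u^2 - 1|^2, since u^2 - 1 has real part 3/2 and imaginary part 2pq.\<close>

definition zparam :: "real \<Rightarrow> real" where
  "zparam q = - 9 / 4 - 4 * q\<^sup>2 * (5 / 2 + q\<^sup>2)"

lemma zparam_less: "q > 0 \<Longrightarrow> zparam q < - 9 / 4"
  by (simp add: zparam_def add_pos_nonneg)

lemma inj_on_zparam: "inj_on zparam {0<..}"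
proof (rule linorder_inj_onI')
  fix x y :: real
  assume "x \<in> {0<..}" "y \<in> {0<..}" "x < y"
  then have "x\<^sup>2 < y\<^sup>2" by (simp add: power_strict_mono)
  then have "x\<^sup>2 * (5 / 2 + x\<^sup>2) < y\<^sup>2 * (5 / 2 + y\<^sup>2)"
    by (intro mult_strict_mono) (auto simp: add_nonneg_nonneg)
  then show "zparam x \<noteq> zparam y" by (simp add: zparam_def)
qed

text \<open>Up to the common factor 1/(64 i p q), the partial fraction of the root (1+u)^2 at
  exponent m + 3; \<open>minor_term\<close> is that of (1-u)^2.\<close>

definition main_term :: "nat \<Rightarrow> real \<Rightarrow> complex" where
  "main_term m q = (let p = abscissa q in
     (1 + Complex p q) ^ (2 * m + 6) / (of_real (1 + p) * Complex 1 q * Complex p q))"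

definition minor_term :: "nat \<Rightarrow> real \<Rightarrow> complex" where
  "minor_term m q = (let p = abscissa q in
     (1 - Complex p q) ^ (2 * m + 6) / (of_real (p - 1) * Complex 1 (- q) * Complex p q))"

lemma gen_denom_coeff_eq_Im:
  fixes P :: "nat \<Rightarrow> complex poly"
  assumes gf: "\<And>z :: complex. Abs_fps (\<lambda>m. poly (P m) z) = 1 / gen_denom z"
    and q: "q > 0"
  shows "poly (P m) (of_real (zparam q))
    = of_real (Im (main_term m q + minor_term m q) / (32 * abscissa q * q))"
proof -
  define p where "p = abscissa q"
  have p: "p > 1" "p\<^sup>2 = 5 / 2 + q\<^sup>2"
    using abscissa_gt_1 abscissa_square by (simp_all add: p_def)
  define u where "u = Complex p q"
  define v where "v = Complex p (- q)"
  define z :: complex where "z = of_real (zparam q)"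
  define a b c d where abcd: "a = (1 + u)\<^sup>2" "b = (1 - u)\<^sup>2" "c = (1 + v)\<^sup>2" "d = (1 - v)\<^sup>2"
  have uv: "u\<^sup>2 + v\<^sup>2 = 5"
    using p by (simp add: u_def v_def complex_eq_iff Re_power2 Im_power2)
  have z: "z = - (u\<^sup>2 - 1) * (v\<^sup>2 - 1)"
  proof -
    have "u\<^sup>2 - 1 = Complex (3 / 2) (2 * p * q)" "v\<^sup>2 - 1 = Complex (3 / 2) (- (2 * p * q))"
      using p by (simp_all add: u_def v_def complex_eq_iff Re_power2 Im_power2)
    then have "- (u\<^sup>2 - 1) * (v\<^sup>2 - 1) = - Complex (3 / 2) (2 * p * q) * Complex (3 / 2) (- (2 * p * q))"
      by (simp only:)
    also have "\<dots> = of_real (- 9 / 4 - 4 * q\<^sup>2 * p\<^sup>2)"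
      by (simp add: complex_eq_iff power2_eq_square)
    finally show ?thesis by (simp only: z_def zparam_def p(2))
  qed
  \<comment> \<open>All are differences of squares, factored with u + v = 2p and u - v =
    2iq.\<close>
  have diffs: "a - b = 4 * u" "c - d = 4 * v"
    "a - c = (2 * \<i> * of_real q) * (2 * of_real (1 + p))"
    "a - d = (2 * of_real p) * (2 * Complex 1 q)"
    "b - c = - (2 * of_real p) * (2 * Complex 1 (- q))"
    "b - d = (2 * \<i> * of_real q) * (2 * of_real (p - 1))"
    by (simp_all add: abcd u_def v_def complex_eq_iff power2_eq_square algebra_simps)
  have nz: "u \<noteq> 0" "v \<noteq> 0" "Complex 1 q \<noteq> 0" "Complex 1 (- q) \<noteq> 0"
    using p q by (auto simp: u_def v_def complex_eq_iff)
  have nz': "a - b \<noteq> 0" "a - c \<noteq> 0" "a - d \<noteq> 0" "b - c \<noteq> 0" "b - d \<noteq> 0" "c - d \<noteq> 0"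
    unfolding diffs using nz p q by (auto simp: complex_eq_iff)
  then have distinct: "a \<noteq> b" "a \<noteq> c" "a \<noteq> d" "b \<noteq> c" "b \<noteq> d" "c \<noteq> d"
    by auto
  have sym: "a + b + c + d = 14"
    "a * b + a * c + a * d + b * c + b * d + c * d = 49 - 2 * z"
    "a * b * c + a * b * d + a * c * d + b * c * d = 2 * z + 36"
    "a * b * c * d = z\<^sup>2"
  proof -
    have v: "v\<^sup>2 = 5 - u\<^sup>2" using uv by (simp add: algebra_simps)
    \<comment> \<open>Paired like this, the symmetric functions depend on u^2 and v^2 only, so v^2 =
      5 - u^2 reduces each claim to an identity in u^2.\<close>
    have ab: "a + b = 2 + 2 * u\<^sup>2" "a * b = (1 - u\<^sup>2)\<^sup>2"
      and cd: "c + d = 2 + 2 * v\<^sup>2" "c * d = (1 - v\<^sup>2)\<^sup>2"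
      by (simp_all add: abcd power2_eq_square algebra_simps)
    have regroup: "a + b + c + d = (a + b) + (c + d)"
      "a * b + a * c + a * d + b * c + b * d + c * d = a * b + (a + b) * (c + d) + c * d"
      "a * b * c + a * b * d + a * c * d + b * c * d = a * b * (c + d) + (a + b) * (c * d)"
      "a * b * c * d = (a * b) * (c * d)"
      by (simp_all add: algebra_simps)
    show "a + b + c + d = 14"
      "a * b + a * c + a * d + b * c + b * d + c * d = 49 - 2 * z"
      "a * b * c + a * b * d + a * c * d + b * c * d = 2 * z + 36"
      "a * b * c * d = z\<^sup>2"
      unfolding regroup unfolding ab cd unfolding z v by (simp_all add: power2_eq_square algebra_simps)
  qed
  define h where "h n = a ^ n / ((a - b) * (a - c) * (a - d)) + b ^ n / ((b - a) * (b - c) * (b - d))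
     + c ^ n / ((c - a) * (c - b) * (c - d)) + d ^ n / ((d - a) * (d - b) * (d - c))" for n
  note h = partial_fraction_sum_recurrence[OF distinct, folded h_def, unfolded sym]
  define g where "g n = (if n < 3 then 0 else poly (P (n - 3)) z)" for n
  note g = gen_denom_inverse_recurrence[OF gf[of z], folded g_def]
  \<comment> \<open>Both sequences start with 0, 0, 0, 1 and satisfy the same recurrence.\<close>
  have "g (m + 3) = h (m + 3)"
  proof (rule linear_recurrence4_unique[OF g(2) h(5)])
    show "g 0 = h 0" "g 1 = h 1" "g 2 = h 2" unfolding h(1-3) by (simp_all add: g_def)
    show "g 3 = h 3" unfolding g(1) h(4) ..
  qed
  then have P: "poly (P m) z = h (m + 3)"
    by (simp add: g_def)
  define W where "W = main_term m q + minor_term m q"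
  have pow: "a ^ (m + 3) = (1 + u) ^ (2 * m + 6)" "b ^ (m + 3) = (1 - u) ^ (2 * m + 6)"
    by (simp_all add: abcd flip: power_mult)
  have first: "a ^ (m + 3) / ((a - b) * (a - c) * (a - d)) = main_term m q / (64 * \<i> * of_real (p * q))"
    unfolding main_term_def Let_def p_def[symmetric] u_def[symmetric] pow diffs by (simp add: mult_ac)
  have "b - a = - 4 * u" using diffs(1) by algebra
  then have second: "b ^ (m + 3) / ((b - a) * (b - c) * (b - d)) = minor_term m q / (64 * \<i> * of_real (p * q))"
    unfolding minor_term_def Let_def p_def[symmetric] u_def[symmetric] pow diffs by (simp add: mult_ac)
  \<comment> \<open>Hence the last two partial fractions are the conjugates of the first two, and
    the sum is twice a real part. The i in the denominator then turns the real part into an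
    imaginary part.\<close>
  have cnj: "c = cnj a" "d = cnj b"
    by (simp_all add: abcd u_def v_def complex_eq_iff power2_eq_square)
  have "a ^ (m + 3) / ((a - b) * (a - c) * (a - d)) + b ^ (m + 3) / ((b - a) * (b - c) * (b - d))
     = W / (64 * \<i> * of_real (p * q))" (is "?L = _")
    unfolding first second W_def by (simp add: add_divide_distrib)
  moreover have "c ^ (m + 3) / ((c - a) * (c - b) * (c - d)) + d ^ (m + 3) / ((d - a) * (d - b) * (d - c)) = cnj ?L"
    by (simp add: cnj mult_ac)
  ultimately have "poly (P m) z = W / (64 * \<i> * of_real (p * q)) + cnj (W / (64 * \<i> * of_real (p * q)))"
    unfolding P h_def by (simp only: add.assoc)
  also have "\<dots> = of_real (2 * Re (W / (64 * \<i> * of_real (p * q))))"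
    by (rule complex_add_cnj)
  also have "W / (64 * \<i> * of_real (p * q)) = of_real (1 / (64 * (p * q))) * - (\<i> * W)"
    by (simp add: complex_eq_iff Re_divide Im_divide)
  also have "2 * Re \<dots> = Im W / (32 * p * q)"
    by simp
  finally show ?thesis
    by (simp only: z_def W_def p_def)
qed

section \<open>Argument and dominance of the main term\<close>

text \<open>The factors 1 + u, 1 + iq and u lie in the right half-plane, so arctangents give their
  arguments. Their unreduced combination is a continuous branch that may exceed pi, as counting the
  sign changes requires.\<close>

definition phase :: "nat \<Rightarrow> real \<Rightarrow> real" where
  "phase m q = (2 * m + 6) * arctan (q / (1 + abscissa q)) - arctan q - arctan (q / abscissa q)"

lemma main_term_polar: "main_term m q = of_real (cmod (main_term m q)) * cis (phase m q)"
proof -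
  define p where "p = abscissa q"
  have p: "p > 1" using abscissa_gt_1 by (simp add: p_def)
  have *: "1 + Complex p q = Complex (1 + p) q" by (simp add: complex_eq_iff)
  define A B C where "A = Complex (1 + p) q" and "B = Complex 1 q" and "C = Complex p q"
  have polar: "A = of_real (cmod A) * cis (arctan (q / (1 + p)))"
    "B = of_real (cmod B) * cis (arctan q)"
    "C = of_real (cmod C) * cis (arctan (q / p))"
    using Complex_eq_cis_arctan[of "1 + p" q] Complex_eq_cis_arctan[of 1 q]
      Complex_eq_cis_arctan[of p q] p by (simp_all add: A_def B_def C_def)
  have main: "main_term m q = A ^ (2 * m + 6) / (of_real (1 + p) * B * C)"
    unfolding main_term_def Let_def p_def[symmetric] * A_def B_def C_def ..
  have "main_term m q = (of_real (cmod A) * cis (arctan (q / (1 + p)))) ^ (2 * m + 6) /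
      (of_real (1 + p) * (of_real (cmod B) * cis (arctan q)) * (of_real (cmod C) * cis (arctan (q / p))))"
    unfolding main by (simp only: polar[symmetric])
  also have "\<dots> = of_real (cmod A ^ (2 * m + 6) / ((1 + p) * cmod B * cmod C)) *
      (cis (arctan (q / (1 + p))) ^ (2 * m + 6) / cis (arctan q) / cis (arctan (q / p)))"
    by (simp add: power_mult_distrib mult_ac)
  also have "cis (arctan (q / (1 + p))) ^ (2 * m + 6) / cis (arctan q) / cis (arctan (q / p)) = cis (phase m q)"
    unfolding phase_def p_def[symmetric] by (simp only: DeMoivre cis_divide) simp
  also have "cmod A ^ (2 * m + 6) / ((1 + p) * cmod B * cmod C) = cmod (main_term m q)"
    unfolding main using p by (simp add: norm_divide norm_mult norm_power del: of_real_add)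
  finally show ?thesis .
qed

text \<open>The numerator of \<open>main_term\<close> is larger in modulus, but so is its
  denominator, by the ratio (p+1)/(p-1). One factor |1+u|^2/|1-u|^2 already outweighs that ratio,
  because p^2 - q^2 > 1; the remaining factors only help.\<close>

lemma minor_term_less: "cmod (minor_term m q) < cmod (main_term m q)"
proof -
  define p where "p = abscissa q"
  have p: "p > 1" "p\<^sup>2 = 5 / 2 + q\<^sup>2"
    using abscissa_gt_1 abscissa_square by (simp_all add: p_def)
  define x y where "x = cmod (1 - Complex p q) ^ 2" and "y = cmod (1 + Complex p q) ^ 2"
  have xy: "x = (p - 1)\<^sup>2 + q\<^sup>2" "y = (1 + p)\<^sup>2 + q\<^sup>2"
    unfolding x_def y_def cmod_power2 by (simp_all add: power2_eq_square algebra_simps)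
  have x0: "x > 0" using p by (simp add: xy add_pos_nonneg)
  have "y - x = 4 * p" unfolding xy by algebra
  then have "x < y" using p by simp
  have "y * (p - 1) - x * (1 + p) = 2 * (p\<^sup>2 - 1 - q\<^sup>2)"
    unfolding xy by algebra
  then have "x * (1 + p) < y * (p - 1)" using p by simp
  moreover have "x ^ (m + 2) \<le> y ^ (m + 2)" "0 < x ^ (m + 2)" "0 \<le> x * (1 + p)"
    using x0 \<open>x < y\<close> p by (simp_all add: power_mono del: power_Suc add_2_eq_Suc')
  ultimately have "x ^ (m + 2) * (x * (1 + p)) < y ^ (m + 2) * (y * (p - 1))"
    by (intro mult_le_less_imp_less[of "x ^ (m + 2)" "y ^ (m + 2)" "x * (1 + p)"])
  then have "x ^ (m + 3) * (1 + p) < y ^ (m + 3) * (p - 1)"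
    by (simp add: eval_nat_numeral mult_ac)
  then have "x ^ (m + 3) / (p - 1) < y ^ (m + 3) / (1 + p)"
    using p by (simp add: field_simps)
  moreover define K where "K = cmod (Complex 1 q) * cmod (Complex p q)"
  have "K > 0" using p by (simp add: K_def complex_eq_iff)
  ultimately have "x ^ (m + 3) / (p - 1) / K < y ^ (m + 3) / (1 + p) / K"
    by (rule divide_strict_right_mono)
  moreover have "cmod (Complex 1 (- q)) = cmod (Complex 1 q)"
    by (simp add: complex_norm)
  then have "cmod (minor_term m q) = x ^ (m + 3) / (p - 1) / K"
    unfolding minor_term_def Let_def p_def[symmetric] using p
    by (simp add: norm_divide norm_mult norm_power x_def K_def del: of_real_diff flip: power_mult)
  moreover have "cmod (main_term m q) = y ^ (m + 3) / (1 + p) / K"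
    unfolding main_term_def Let_def p_def[symmetric] using p
    by (simp add: norm_divide norm_mult norm_power y_def K_def del: of_real_add flip: power_mult)
  ultimately show ?thesis by simp
qed

text \<open>Here the main term is purely imaginary, so its whole modulus counts and the strictly
  smaller minor term cannot change the sign.\<close>

lemma sign_at_phase:
  assumes "phase m q = pi / 2 + real k * pi"
  shows "0 < (- 1) ^ k * Im (main_term m q + minor_term m q)"
proof -
  have "sin (phase m q) = (- 1) ^ k"
    unfolding assms by (simp add: sin_add)
  then have "Im (main_term m q) = cmod (main_term m q) * (- 1) ^ k"
    by (subst main_term_polar) simp
  then have "(- 1) ^ k * Im (main_term m q) = cmod (main_term m q)"
    by (simp flip: power_add mult_2)
  moreover have "\<bar>(- 1) ^ k * Im (minor_term m q)\<bar> < cmod (main_term m q)"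
    using abs_Im_le_cmod[of "minor_term m q"] minor_term_less[of m q] by (simp add: abs_mult)
  ultimately show ?thesis by (simp add: ring_distribs)
qed

lemma continuous_on_phase: "continuous_on A (phase m)"
proof -
  have "continuous_on A abscissa"
    unfolding abscissa_def by (intro continuous_intros)
  moreover have "abscissa x \<noteq> 0" "1 + abscissa x \<noteq> 0" for x
    using abscissa_gt_1[of x] by auto
  ultimately show ?thesis
    unfolding phase_def by (intro continuous_intros) auto
qed

text \<open>The three arctangents tend to pi/4, pi/2 and pi/4.\<close>

lemma phase_limit: "(phase m \<longlongrightarrow> real m * pi / 2 + 3 * pi / 4) at_top"
proof -
  have 1: "((\<lambda>q. q / (1 + abscissa q)) \<longlongrightarrow> 1) at_top" "((\<lambda>q. q / abscissa q) \<longlongrightarrow> 1) at_top"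
    unfolding abscissa_def by real_asymp+
  have "(phase m \<longlongrightarrow> real (2 * m + 6) * arctan 1 - pi / 2 - arctan 1) at_top"
    unfolding phase_def using 1 by (intro tendsto_intros tendsto_arctan_at_top) auto
  moreover have "real (2 * m + 6) * arctan 1 - pi / 2 - arctan 1 = real m * pi / 2 + 3 * pi / 4"
    by (simp add: arctan_one field_simps)
  ultimately show ?thesis by simp
qed

text \<open>The intermediate value theorem on a half-line: \<open>2 * k \<le> m\<close> keeps the
  target at least pi/4 below the limit. Monotonicity of \<open>phase\<close> is avoided by searching
  only to the right of \<open>x\<close>.\<close>

lemma phase_attains:
  assumes "phase m x < pi / 2 + real k * pi" "2 * k \<le> m"
  obtains y where "y > x" "phase m y = pi / 2 + real k * pi"
proof -
  have "2 * real k \<le> real m" using assms by linarith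
  then have "2 * (real k * pi) \<le> real m * pi"
    using mult_right_mono[of "2 * real k" "real m" pi] by (simp add: mult_ac)
  then have "pi / 2 + real k * pi < real m * pi / 2 + 3 * pi / 4" 
    using pi_gt_zero by linarith
  from order_tendstoD(1)[OF phase_limit this]
  have "eventually (\<lambda>y. pi / 2 + real k * pi < phase m y) at_top" .
  then obtain w where "w > x" "pi / 2 + real k * pi < phase m w"
    using eventually_gt_at_top[of x] eventually_happens'[OF trivial_limit_at_top_linorder]
    by (metis (mono_tags, lifting) eventually_conj)
  then obtain y where "y \<ge> x" "phase m y = pi / 2 + real k * pi"
    using IVT'[of "phase m" x "pi / 2 + real k * pi" w] assms continuous_on_phase by auto
  moreover from this have "y \<noteq> x" using assms by auto
  ultimately show ?thesis using that[of y] by auto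
qed

section \<open>Counting the zeros\<close>

text \<open>The induction carries the last sign point \<open>x\<close> along with the zeros. The
  next sign point is sought beyond \<open>x\<close>, so the zero found between the two is
  new.\<close>

lemma real_zeros_exist:
  fixes P :: "nat \<Rightarrow> complex poly"
  assumes gf: "\<And>z :: complex. Abs_fps (\<lambda>m. poly (P m) z) = 1 / gen_denom z"
    and "2 * k \<le> m"
  shows "\<exists>S x. finite S \<and> card S = k \<and> x > 0 \<and> S \<subseteq> {0<..<x} \<and>
    (\<forall>q\<in>S. poly (P m) (of_real (zparam q)) = 0) \<and> phase m x = pi / 2 + real k * pi"
  using assms(2)
proof (induction k)
  case 0
  have "phase m 0 = 0" by (simp add: phase_def)
  then obtain x where "x > 0" "phase m x = pi / 2 + real 0 * pi"
    using phase_attains[of m 0 0] by auto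
  then show ?case by (intro exI[of _ "{}"] exI[of _ x]) simp
next
  case (Suc k)
  then obtain S x where S: "finite S" "card S = k" "x > 0" "S \<subseteq> {0<..<x}"
    "\<forall>q\<in>S. poly (P m) (of_real (zparam q)) = 0" "phase m x = pi / 2 + real k * pi"
    by auto
  obtain y where y: "x < y" "phase m y = pi / 2 + real (Suc k) * pi"
  proof (rule phase_attains)
    show "phase m x < pi / 2 + real (Suc k) * pi" by (simp add: S(6) ring_distribs)
  qed (rule Suc.prems)
  \<comment> \<open>Written through the polynomial, \<open>g\<close> is visibly continuous;
    \<open>gen_denom_coeff_eq_Im\<close> supplies its signs. The factor (-1)^k makes it positive at
    \<open>x\<close> and negative at \<open>y\<close>.\<close>
  define g where "g q = (- 1) ^ k * Re (poly (P m) (of_real (zparam q)))" for q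
  have g: "g q = (- 1) ^ k * Im (main_term m q + minor_term m q) / (32 * abscissa q * q)" if "q > 0" for q
    by (simp only: g_def gen_denom_coeff_eq_Im[OF gf that] Re_complex_of_real) simp
  have pos: "0 < 32 * abscissa q * q" if "q > 0" for q
    using that abscissa_gt_1[of q] by simp
  have "g x > 0"
    unfolding g[OF S(3)] by (intro divide_pos_pos sign_at_phase pos S)
  moreover have "g y < 0"
    using S(3) y sign_at_phase[OF y(2)] by (subst g) (auto intro!: divide_neg_pos pos)
  moreover have "continuous_on {x..y} g"
    unfolding g_def zparam_def by (intro continuous_intros)
  ultimately obtain w where w: "x \<le> w" "w \<le> y" "g w = 0"
    using IVT2'[of g y 0 x] y by auto
  with \<open>g x > 0\<close> \<open>g y < 0\<close> have "w \<noteq> x" "w \<noteq> y" by auto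
  with w have xw: "x < w" "w < y" by auto
  \<comment> \<open>The value at \<open>zparam w\<close> is real, so a vanishing real part
    suffices.\<close>
  have "poly (P m) (of_real (zparam w)) = 0"
  proof -
    have "w > 0" using S(3) xw by simp
    moreover have "Re (poly (P m) (of_real (zparam w))) = 0"
      using w(3) by (simp add: g_def)
    ultimately show ?thesis
      unfolding gen_denom_coeff_eq_Im[OF gf \<open>w > 0\<close>] by (simp only: Re_complex_of_real of_real_0)
  qed
  moreover have "w \<notin> S" using S(4) xw by auto
  ultimately show ?case
    using S xw y by (intro exI[of _ "insert w S"] exI[of _ y]) auto
qed

theorem theorem1:
  fixes P :: "nat \<Rightarrow> complex poly"
  assumes "\<And>z :: complex. Abs_fps (\<lambda>m. poly (P m) z) = 1 / gen_denom z"
  shows "\<forall>m. {z. poly (P m) z = 0} \<subseteq> complex_of_real ` {..< - 9 / 4}"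
proof
  fix m
  obtain S x where S: "finite S" "card S = m div 2" "x > 0" "S \<subseteq> {0<..<x}"
    "\<forall>q\<in>S. poly (P m) (of_real (zparam q)) = 0" "phase m x = pi / 2 + real (m div 2) * pi"
    using real_zeros_exist[OF assms, of "m div 2" m] by auto
  \<comment> \<open>The final sign point \<open>x\<close> is a place where the polynomial does not
    vanish.\<close>
  have nz: "P m \<noteq> 0"
  proof
    assume "P m = 0"
    then have "Im (main_term m x + minor_term m x) = 0"
      using gen_denom_coeff_eq_Im[OF assms S(3), of m] S(3) abscissa_gt_1[of x]
      by (simp del: plus_complex.sel)
    with sign_at_phase[OF S(6)] show False by simp
  qed
  define Z where "Z = (\<lambda>q. complex_of_real (zparam q)) ` S"
  have "inj_on zparam S"
    by (rule inj_on_subset[OF inj_on_zparam]) (use S(4) in auto)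
  then have "inj_on (\<lambda>q. complex_of_real (zparam q)) S"
    by (simp add: inj_on_def)
  then have "card Z = m div 2"
    by (simp add: Z_def card_image S)
  moreover have "card {z. poly (P m) z = 0} \<le> m div 2"
    using card_poly_roots_bound[OF nz] degree_gen_denom_coeff[OF assms, of m] by linarith
  moreover have "Z \<subseteq> {z. poly (P m) z = 0}"
    using S(5) by (auto simp: Z_def)
  \<comment> \<open>The zeros found are as many as the degree allows, so no zero lies elsewhere in
    the complex plane.\<close>
  ultimately have "{z. poly (P m) z = 0} = Z"
    using card_seteq[OF poly_roots_finite[OF nz], of Z] by auto
  also have "Z \<subseteq> complex_of_real ` {..< - 9 / 4}"
    using S(4) zparam_less by (force simp: Z_def)
  finally show "{z. poly (P m) z = 0} \<subseteq> complex_of_real ` {..< - 9 / 4}" .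
qed

end
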